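(* There exist absolute constants $c_0>0$ and $c>0$ such that for all sufficiently large integers $R$, the class \[ \mathcal{H}_R(c_0)=\{f:X_R'\to\{-1,1\} : \operatorname{FR}(f)\ge c_0\} \] satisfies $\operatorname{VC}(\mathcal{H}_R(c_0))\ge cR$.
   Context: For an integer $R\ge1$ let $X_R=\{1,2,\dots,R\}$ and let $X_R'$ be the set of squarefree integers in $X_R$ (equivalently, those $n\le R$ with $\mu(n)\neq 0$, where $\mu$ is the Möbius function). A function $f:X_R'\to\{-1,1\}$ is extended to $X_R$ by setting $f(n)=0$ for $n\notin X_R'$. Its Fourier transform is $\widehat f(x)=\sum_{n=1}^R f(n)e^{-2\pi i n x}$, $x\in[0,1]$, and its Fourier Ratio is \[ \operatorname{FR}(f)=\frac{\|\widehat f\|_{L^1([0,1])}}{\|\widehat f\|_{L^2([0,1])}}, \] with norms taken with respect to Lebesgue measure on $[0,1]$. A subset $S\subset X_R'$ is shattered by a class $\mathcal F$ of functions $X_R'\to\{-1,1\}$ if for every $\sigma:S\to\{-1,1\}$ there exists $f\in\mathcal F$ with $f(n)=\sigma(n)$ for all $n\in S$. The Vapnik–Chervonenkis dimension $\operatorname{VC}(\mathcal F)$ is the maximal cardinality of a subset of $X_R'$ shattered by $\mathcal F$. *)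

theory Defs
  imports "HOL-Analysis.Analysis" "HOL-Computational_Algebra.Squarefree"
begin

definition sqfree_upto :: "nat \<Rightarrow> nat set" where
  "sqfree_upto R = {n \<in> {1..R}. squarefree n}"

text \<open>A function from the squarefree integers up to \<open>R\<close> to \<open>{-1, 1}\<close> is represented by its
  extension by zero, so that equal functions have equal representatives.\<close>

definition sign_functions :: "nat \<Rightarrow> (nat \<Rightarrow> real) set" where
  "sign_functions R =
     {f. (\<forall>n \<in> sqfree_upto R. f n \<in> {-1, 1}) \<and> (\<forall>n. n \<notin> sqfree_upto R \<longrightarrow> f n = 0)}"

definition fourier_transform :: "nat \<Rightarrow> (nat \<Rightarrow> real) \<Rightarrow> real \<Rightarrow> complex" where
  "fourier_transform R f x =
     (\<Sum>n = 1..R. complex_of_real (f n) * exp (- 2 * complex_of_real pi * \<i> * of_nat n * complex_of_real x))"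

definition Lp_norm01 :: "real \<Rightarrow> (real \<Rightarrow> complex) \<Rightarrow> real" where
  "Lp_norm01 p g = (LINT x:{0..1}|lborel. norm (g x) powr p) powr (1 / p)"

definition fourier_ratio :: "nat \<Rightarrow> (nat \<Rightarrow> real) \<Rightarrow> real" where
  "fourier_ratio R f =
     Lp_norm01 1 (fourier_transform R f) / Lp_norm01 2 (fourier_transform R f)"

definition shatters :: "(nat \<Rightarrow> real) set \<Rightarrow> nat set \<Rightarrow> bool" where
  "shatters F S \<longleftrightarrow> (\<forall>\<sigma> \<in> S \<rightarrow> {-1, 1}. \<exists>f \<in> F. \<forall>n \<in> S. f n = \<sigma> n)"

text \<open>For finite \<open>X\<close> the supremum is a maximum, except that the empty class, which shatters
  no set at all, gets dimension \<open>0\<close>.\<close>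

definition VC_dim :: "nat set \<Rightarrow> (nat \<Rightarrow> real) set \<Rightarrow> nat" where
  "VC_dim X F = Sup (card ` {S. S \<subseteq> X \<and> shatters F S})"

definition large_FR_class :: "nat \<Rightarrow> real \<Rightarrow> (nat \<Rightarrow> real) set" where
  "large_FR_class R c\<^sub>0 = {f \<in> sign_functions R. fourier_ratio R f \<ge> c\<^sub>0}"

end

theory Submission
  imports Defs
begin

text \<open>Split the squarefree integers up to \<open>R\<close> into halves \<open>S\<close> and \<open>T\<close>. Signs on \<open>T\<close> can be chosen
  one at a time so that the resulting exponential sum \<open>P\<close> has fourth moment at most \<open>3 |T|\<^sup>2\<close>; since
  its second moment is \<open>|T|\<close>, its \<open>L\<^sup>1\<close> norm is at least a constant times \<open>sqrt |T|\<close>. For the exponential sum \<open>A\<close> of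
  any sign pattern on \<open>S\<close>, the inequality \<open>|A + P| + |A - P| \<ge> 2 |P|\<close> shows that \<open>P\<close> or \<open>-P\<close>
  extends the pattern to a function with large Fourier ratio. Hence \<open>S\<close> is shattered, and its size
  is of order \<open>R\<close> because the squarefree integers have positive density.\<close>

section \<open>Exponential sums and their orthogonality\<close>

text \<open>The frequency set is arbitrary, so that a transform can be split over \<open>S\<close>
  and \<open>T\<close>, or built up by inserting one frequency at a time.\<close>

definition exp_sum :: "nat set \<Rightarrow> (nat \<Rightarrow> real) \<Rightarrow> real \<Rightarrow> complex" where
  "exp_sum T a x = (\<Sum>n\<in>T. of_real (a n) * cis (- 2 * pi * real n * x))"

lemma continuous_on_exp_sum [continuous_intros]: "continuous_on A (exp_sum T a)"
  unfolding exp_sum_def by (intro continuous_intros)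

lemma exp_sum_insert:
  "finite T \<Longrightarrow> k \<notin> T \<Longrightarrow>
     exp_sum (insert k T) a x = exp_sum T a x + of_real (a k) * cis (- 2 * pi * real k * x)"
  by (simp add: exp_sum_def)

lemma exp_sum_cong: "(\<And>n. n \<in> T \<Longrightarrow> a n = b n) \<Longrightarrow> exp_sum T a x = exp_sum T b x"
  by (simp add: exp_sum_def)

lemma exp_sum_union_disjoint:
  "finite S \<Longrightarrow> finite T \<Longrightarrow> S \<inter> T = {} \<Longrightarrow> exp_sum (S \<union> T) a x = exp_sum S a x + exp_sum T a x"
  by (simp add: exp_sum_def sum.union_disjoint)

lemma exp_sum_uminus: "exp_sum T (\<lambda>n. - a n) x = - exp_sum T a x"
  by (simp add: exp_sum_def sum_negf)

lemma integral_cos_period: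
  fixes m :: int
  assumes "m \<noteq> 0"
  shows "((\<lambda>x. cos (2 * pi * m * x)) has_integral 0) {0..1}"
proof -
  have "((\<lambda>x. cos (2 * pi * m * x)) has_integral
      (sin (2 * pi * m * 1) / (2 * pi * m) - sin (2 * pi * m * 0) / (2 * pi * m))) {0..1}"
    using assms
    by (intro fundamental_theorem_of_calculus)
       (auto simp flip: has_real_derivative_iff_has_vector_derivative intro!: derivative_eq_intros)
  moreover have "sin (2 * pi * m) = 0"
    using sin_int_2pin[of m] by simp
  ultimately show ?thesis by simp
qed

text \<open>The real inner product on the complex numbers is the real part of
  \<open>z * cnj w\<close>. Each term thus becomes a cosine of frequency \<open>k - n\<close>,
  nonzero because \<open>k\<close> lies outside \<open>T\<close>, and only real integrals
  occur.\<close>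

lemma integral_inner_exp_sum:
  assumes "finite T" "k \<notin> T"
  shows "((\<lambda>x. exp_sum T a x \<bullet> cis (- 2 * pi * real k * x)) has_integral 0) {0..1}"
proof -
  have "exp_sum T a x \<bullet> cis (- 2 * pi * real k * x) =
      (\<Sum>n\<in>T. a n * cos (2 * pi * (int k - int n) * x))" for x
    unfolding exp_sum_def inner_sum_left
    by (intro sum.cong refl)
       (simp add: inner_complex_def algebra_simps cos_diff)
  moreover have "((\<lambda>x. \<Sum>n\<in>T. a n * cos (2 * pi * (int k - int n) * x)) has_integral
      (\<Sum>n\<in>T. a n * 0)) {0..1}"
    using assms by (intro has_integral_sum has_integral_mult_right integral_cos_period) auto
  ultimately show ?thesis by simp
qed

text \<open>Parseval's identity: each inserted frequency is orthogonal to the earlier ones, so the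
  cross term integrates to zero.\<close>

lemma has_integral_norm_exp_sum_sq:
  assumes "finite T"
  shows "((\<lambda>x. (norm (exp_sum T a x))\<^sup>2) has_integral (\<Sum>n\<in>T. (a n)\<^sup>2)) {0..1}"
  using assms
proof (induction T rule: finite_induct)
  case empty
  then show ?case by (simp add: exp_sum_def)
next
  case (insert k T)
  have eq: "(norm (exp_sum (insert k T) a x))\<^sup>2 = (norm (exp_sum T a x))\<^sup>2 +
      (2 * a k * (exp_sum T a x \<bullet> cis (- 2 * pi * real k * x)) + (a k)\<^sup>2)" for x
  proof -
    let ?z = "cis (- 2 * pi * real k * x)"
    have "(norm (exp_sum (insert k T) a x))\<^sup>2 =
        (norm (exp_sum T a x))\<^sup>2 + (2 * a k * (exp_sum T a x \<bullet> ?z) + (a k)\<^sup>2 * (?z \<bullet> ?z))"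
      unfolding exp_sum_insert[OF insert.hyps] scaleR_conv_of_real [symmetric] power2_norm_eq_inner
      by (simp add: inner_add_left inner_add_right inner_commute
          power2_eq_square algebra_simps)
    also have "?z \<bullet> ?z = 1"
      by (simp flip: power2_norm_eq_inner)
    finally show ?thesis by simp
  qed
  have "((\<lambda>x. (norm (exp_sum T a x))\<^sup>2 +
      (2 * a k * (exp_sum T a x \<bullet> cis (- 2 * pi * real k * x)) + (a k)\<^sup>2)) has_integral
      ((\<Sum>n\<in>T. (a n)\<^sup>2) + (2 * a k * 0 + (a k)\<^sup>2))) {0..1}"
    using has_integral_const_real[of "(a k)\<^sup>2" 0 1]
    by (intro has_integral_add has_integral_mult_right insert.IH integral_inner_exp_sum insert.hyps)
       simp
  then show ?case
    using insert.hyps by (simp add: eq add.commute)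
qed

section \<open>Choice of signs with a small fourth moment\<close>

text \<open>Terms of odd degree in the inner product cancel between the two signs. What remains of
  it is \<open>8 * (w \<bullet> z)\<^sup>2\<close>, which Cauchy-Schwarz bounds.\<close>

lemma norm_fourth_power_parallelogram:
  fixes w z :: "'a :: real_inner"
  shows "norm (w + z) ^ 4 + norm (w - z) ^ 4 \<le>
     2 * (norm w ^ 4 + 6 * (norm w)\<^sup>2 * (norm z)\<^sup>2 + norm z ^ 4)"
proof -
  have fourth: "norm v ^ 4 = (v \<bullet> v)\<^sup>2" for v :: 'a
    by (simp flip: power2_norm_eq_inner power_mult)
  have "(w \<bullet> z)\<^sup>2 \<le> (norm w)\<^sup>2 * (norm z)\<^sup>2"
    using Cauchy_Schwarz_ineq[of w z] by (simp add: power2_norm_eq_inner)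
  moreover have "norm (w + z) ^ 4 = ((norm w)\<^sup>2 + (norm z)\<^sup>2 + 2 * (w \<bullet> z))\<^sup>2"
    by (simp add: fourth power2_norm_eq_inner inner_add_left inner_add_right inner_commute[of z w] algebra_simps)
  moreover have "norm (w - z) ^ 4 = ((norm w)\<^sup>2 + (norm z)\<^sup>2 - 2 * (w \<bullet> z))\<^sup>2"
    by (simp add: fourth power2_norm_eq_inner inner_diff_left inner_diff_right inner_commute[of z w] algebra_simps)
  ultimately show ?thesis
    by (simp add: power2_eq_square power4_eq_xxxx algebra_simps)
qed

text \<open>Averaging over the two signs of a new coefficient raises the fourth moment by at most
  \<open>6 * card T + 1\<close>, so the better sign does no worse than that.\<close>

lemma exists_signs_fourth_moment_le:
  assumes "finite T"
  shows "\<exists>a. (\<forall>n\<in>T. a n \<in> {-1, 1}) \<and>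
    integral {0..1} (\<lambda>x. norm (exp_sum T a x) ^ 4) \<le> 3 * (real (card T))\<^sup>2"
  using assms
proof (induction T rule: finite_induct)
  case empty
  then show ?case by (simp add: exp_sum_def)
next
  case (insert k T)
  then obtain a where a: "\<forall>n\<in>T. a n \<in> {-1, 1}"
    and le: "integral {0..1} (\<lambda>x. norm (exp_sum T a x) ^ 4) \<le> 3 * (real (card T))\<^sup>2"
    by blast
  define I where "I s = integral {0..1} (\<lambda>x. norm (exp_sum (insert k T) (a(k := s)) x) ^ 4)" for s
  have int: "(\<lambda>x. norm (exp_sum U b x) ^ 4) integrable_on {0..1}" for U b
    by (intro integrable_continuous_real continuous_intros)
  have sq: "((\<lambda>x. (norm (exp_sum T a x))\<^sup>2) has_integral real (card T)) {0..1}"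
  proof -
    have "(\<Sum>n\<in>T. (a n)\<^sup>2) = (\<Sum>n\<in>T. 1)"
      using a by (intro sum.cong) auto
    with has_integral_norm_exp_sum_sq[OF insert.hyps(1), of a] show ?thesis by simp
  qed
  have upd: "exp_sum (insert k T) (a(k := s)) x =
      exp_sum T a x + of_real s * cis (- 2 * pi * real k * x)" for s x
  proof -
    have "exp_sum T (a(k := s)) x = exp_sum T a x"
      using insert.hyps by (intro exp_sum_cong) auto
    then show ?thesis
      using insert.hyps by (simp add: exp_sum_insert)
  qed
  have "I 1 + I (-1) = integral {0..1} (\<lambda>x. norm (exp_sum (insert k T) (a(k := 1)) x) ^ 4 +
      norm (exp_sum (insert k T) (a(k := -1)) x) ^ 4)"
    unfolding I_def by (intro integral_add [symmetric] int)
  also have "\<dots> \<le> 2 * (integral {0..1} (\<lambda>x. norm (exp_sum T a x) ^ 4) + 6 * real (card T) + 1)"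
  proof (rule has_integral_le[OF integrable_integral])
    show "((\<lambda>x. 2 * (norm (exp_sum T a x) ^ 4 + 6 * (norm (exp_sum T a x))\<^sup>2 + 1)) has_integral
      2 * (integral {0..1} (\<lambda>x. norm (exp_sum T a x) ^ 4) + 6 * real (card T) + 1)) {0..1}"
      using has_integral_const_real[of "1::real" 0 1]
      by (intro has_integral_mult_right has_integral_add integrable_integral int sq) simp
    show "norm (exp_sum (insert k T) (a(k := 1)) x) ^ 4 +
        norm (exp_sum (insert k T) (a(k := -1)) x) ^ 4
        \<le> 2 * (norm (exp_sum T a x) ^ 4 + 6 * (norm (exp_sum T a x))\<^sup>2 + 1)" for x
      using norm_fourth_power_parallelogram[of "exp_sum T a x" "cis (- 2 * pi * real k * x)"]
      by (simp add: upd)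
  qed (intro integrable_add int)
  \<comment> \<open>With \<open>m = card T\<close>, this is 3 m^2 + 6 m + 1 \<le> 3 (m +
    1)^2.\<close>
  also have "\<dots> \<le> 2 * (3 * (real (card (insert k T)))\<^sup>2)"
    using le insert.hyps by (simp add: power2_eq_square algebra_simps)
  finally have "I 1 \<le> 3 * (real (card (insert k T)))\<^sup>2 \<or> I (-1) \<le> 3 * (real (card (insert k T)))\<^sup>2"
    by linarith
  then obtain s where "s \<in> {-1, 1}" "I s \<le> 3 * (real (card (insert k T)))\<^sup>2"
    by blast
  moreover from this have "\<forall>n\<in>insert k T. (a(k := s)) n \<in> {-1, 1}"
    using a by auto
  ultimately show ?case
    unfolding I_def by blast
qed

section \<open>From the second and fourth moments to the \<open>L1\<close> norm\<close>

text \<open>For \<open>u = t / s\<close>, the polynomial \<open>u - 4/27 u\<^sup>3\<close> has its maximum \<open>1\<close> on \<open>u \<ge> 0\<close> at \<open>u = 3/2\<close>.\<close>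

lemma ge_second_minus_fourth_power:
  fixes t s :: real
  assumes "t \<ge> 0" "s > 0"
  shows "t \<ge> t\<^sup>2 / s - 4 / 27 * t ^ 4 / s ^ 3"
proof -
  define u where "u = t / s"
  have u: "u \<ge> 0" "t = u * s"
    using assms by (auto simp: u_def)
  have "u * ((u - 3 / 2)\<^sup>2 * (u + 3)) \<ge> 0"
    using u by simp
  moreover have "u * ((u - 3 / 2)\<^sup>2 * (u + 3)) = u ^ 4 - 27 / 4 * u\<^sup>2 + 27 / 4 * u"
    by (simp add: field_simps eval_nat_numeral)
  ultimately have "u\<^sup>2 - 4 / 27 * u ^ 4 \<le> u"
    by linarith
  then have "s * (u\<^sup>2 - 4 / 27 * u ^ 4) \<le> s * u"
    using assms by (intro mult_left_mono) auto
  moreover have "s * (u\<^sup>2 - 4 / 27 * u ^ 4) = t\<^sup>2 / s - 4 / 27 * t ^ 4 / s ^ 3"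
    using assms by (simp add: u field_simps eval_nat_numeral)
  ultimately show ?thesis
    using u by (simp add: mult.commute)
qed

text \<open>Integrating the pointwise polynomial bound takes the place of Hoelder's inequality
  between \<open>L1\<close>, \<open>L2\<close> and \<open>L4\<close>. With \<open>s\<close> the
  \<open>L2\<close> norm, the constant is 1 - (4/27) * 3 = 5/9.\<close>

lemma exists_signs_L1_norm_ge:
  assumes "finite T"
  shows "\<exists>a. (\<forall>n\<in>T. a n \<in> {-1, 1}) \<and>
    integral {0..1} (\<lambda>x. norm (exp_sum T a x)) \<ge> 5 / 9 * sqrt (card T)"
proof (cases "T = {}")
  case True
  then show ?thesis by (simp add: exp_sum_def)
next
  case False
  define s where "s = sqrt (card T)"
  have s: "s > 0" "s\<^sup>2 = real (card T)"
    using False assms unfolding s_def by (simp_all add: card_gt_0_iff)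
  obtain a where a: "\<forall>n\<in>T. a n \<in> {-1, 1}"
    and le: "integral {0..1} (\<lambda>x. norm (exp_sum T a x) ^ 4) \<le> 3 * (real (card T))\<^sup>2"
    using exists_signs_fourth_moment_le[OF assms] by blast
  have "(\<Sum>n\<in>T. (a n)\<^sup>2) = (\<Sum>n\<in>T. 1)"
    using a by (intro sum.cong) auto
  then have sq: "((\<lambda>x. (norm (exp_sum T a x))\<^sup>2) has_integral s\<^sup>2) {0..1}"
    using has_integral_norm_exp_sum_sq[OF assms, of a] s by simp
  define J where "J = integral {0..1} (\<lambda>x. norm (exp_sum T a x) ^ 4)"
  have J: "J \<le> 3 * s ^ 4"
    using le by (simp add: J_def flip: s(2))
  have "5 / 9 * s = s\<^sup>2 / s - 4 / 27 * (3 * s ^ 4) / s ^ 3"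
    using s(1) by (simp add: field_simps eval_nat_numeral)
  also have "\<dots> \<le> s\<^sup>2 / s - 4 / 27 * J / s ^ 3"
    using J s by (intro diff_left_mono divide_right_mono mult_left_mono) auto
  also have "\<dots> \<le> integral {0..1} (\<lambda>x. norm (exp_sum T a x))"
  proof (rule has_integral_le)
    show "((\<lambda>x. (norm (exp_sum T a x))\<^sup>2 / s - 4 / 27 * norm (exp_sum T a x) ^ 4 / s ^ 3)
        has_integral (s\<^sup>2 / s - 4 / 27 * J / s ^ 3)) {0..1}"
      unfolding J_def
      by (intro has_integral_diff has_integral_divide has_integral_mult_right sq integrable_integral
          integrable_continuous_real continuous_intros)
    show "((\<lambda>x. norm (exp_sum T a x)) has_integral
        integral {0..1} (\<lambda>x. norm (exp_sum T a x))) {0..1}"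
      by (intro integrable_integral integrable_continuous_real continuous_intros)
  qed (use s ge_second_minus_fourth_power in auto)
  finally show ?thesis
    using a unfolding s_def by blast
qed

section \<open>The Fourier ratio of a sign function\<close>

lemma finite_sqfree_upto [simp]: "finite (sqfree_upto R)"
  by (simp add: sqfree_upto_def)

lemma fourier_transform_eq_exp_sum:
  assumes "f \<in> sign_functions R"
  shows "fourier_transform R f = exp_sum (sqfree_upto R) f"
proof
  fix x
  have "fourier_transform R f x =
      (\<Sum>n = 1..R. of_real (f n) * cis (- 2 * pi * real n * x))"
    unfolding fourier_transform_def cis_conv_exp by (intro sum.cong refl) (simp add: algebra_simps)
  also have "\<dots> = exp_sum (sqfree_upto R) f x"
    unfolding exp_sum_def using assms
    by (intro sum.mono_neutral_right) (auto simp: sqfree_upto_def sign_functions_def)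
  finally show "fourier_transform R f x = exp_sum (sqfree_upto R) f x" .
qed

lemma LINT_eq_integral_Icc:
  fixes g :: "real \<Rightarrow> real"
  assumes "continuous_on {0..1} g"
  shows "(LINT x:{0..1}|lborel. g x) = integral {0..1} g"
  using assms by (intro set_borel_integral_eq_integral(2) borel_integrable_atLeastAtMost')

text \<open>By Parseval all sign functions have the same \<open>L2\<close> norm, so a large ratio
  only requires a large \<open>L1\<close> norm.\<close>

lemma fourier_ratio_sign_function:
  assumes "f \<in> sign_functions R"
  shows "fourier_ratio R f = integral {0..1} (\<lambda>x. norm (exp_sum (sqfree_upto R) f x)) /
    sqrt (card (sqfree_upto R))"
proof -
  let ?g = "exp_sum (sqfree_upto R) f"
  have "(\<Sum>n\<in>sqfree_upto R. (f n)\<^sup>2) = (\<Sum>n\<in>sqfree_upto R. 1)"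
    using assms by (intro sum.cong) (auto simp: sign_functions_def)
  then have "integral {0..1} (\<lambda>x. (norm (?g x))\<^sup>2) = real (card (sqfree_upto R))"
    using has_integral_norm_exp_sum_sq[of "sqfree_upto R" f] by (simp add: integral_unique)
  moreover have "(LINT x:{0..1}|lborel. (norm (?g x))\<^sup>2) = integral {0..1} (\<lambda>x. (norm (?g x))\<^sup>2)"
    by (intro LINT_eq_integral_Icc continuous_intros)
  moreover have "(LINT x:{0..1}|lborel. norm (?g x)) = integral {0..1} (\<lambda>x. norm (?g x))"
    by (intro LINT_eq_integral_Icc continuous_intros)
  moreover have "integral {0..1} (\<lambda>x. norm (?g x)) \<ge> 0"
    by (intro integral_nonneg integrable_continuous_real continuous_intros) auto
  ultimately show ?thesis
    by (simp add: fourier_ratio_def Lp_norm01_def fourier_transform_eq_exp_sum[OF assms] powr_half_sqrt)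
qed

section \<open>Shattering and the VC dimension\<close>

text \<open>The size condition leaves at least half of the squarefree integers for the freely chosen
  signs, so their \<open>L1\<close> norm is comparable to the full \<open>L2\<close> norm.\<close>

lemma shatters_large_FR_class:
  assumes "S \<subseteq> sqfree_upto R" "2 * card S \<le> card (sqfree_upto R)" "R \<ge> 1"
  shows "shatters (large_FR_class R (1/3)) S"
  unfolding shatters_def
proof
  fix \<sigma> :: "nat \<Rightarrow> real"
  assume \<sigma>: "\<sigma> \<in> S \<rightarrow> {-1, 1}"
  define X where "X = sqfree_upto R"
  define T where "T = X - S"
  have fin: "finite S" "finite T" and disj: "S \<inter> T = {}" and X: "X = S \<union> T"
    using assms by (auto simp: X_def T_def intro: finite_subset)
  have cardT: "2 * card T \<ge> card X"
    using assms fin by (simp add: T_def X_def card_Diff_subset)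
  have pos: "card X > 0"
    using assms by (auto simp: X_def card_gt_0_iff sqfree_upto_def intro!: exI[of _ 1])
  obtain a where a: "\<forall>n\<in>T. a n \<in> {-1, 1}"
    and L1: "integral {0..1} (\<lambda>x. norm (exp_sum T a x)) \<ge> 5 / 9 * sqrt (card T)"
    using exists_signs_L1_norm_ge[OF fin(2)] by blast
  define f where "f s n = (if n \<in> S then \<sigma> n else if n \<in> T then s * a n else 0)" for s n
  define I where "I s = integral {0..1} (\<lambda>x. norm (exp_sum X (f s) x))" for s
  have f: "f s \<in> sign_functions R" if "s \<in> {-1, 1}" for s
  proof -
    have "f s n \<in> {-1, 1}" if "n \<in> X" for n
    proof (cases "n \<in> S")
      case True
      then show ?thesis
        using \<sigma> by (auto simp: f_def)
    next
      case False
      with that have "n \<in> T" by (simp add: T_def)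
      with a have "a n \<in> {-1, 1}" by blast
      with False \<open>n \<in> T\<close> \<open>s \<in> {-1, 1}\<close> show ?thesis
        by (auto simp: f_def)
    qed
    moreover have "f s n = 0" if "n \<notin> X" for n
      using that by (simp add: f_def X)
    ultimately show ?thesis
      by (simp add: sign_functions_def flip: X_def)
  qed
  have int: "(\<lambda>x. norm (exp_sum U b x)) integrable_on {0..1}" for U b
    by (intro integrable_continuous_real continuous_intros)
  have split: "exp_sum X (f s) x = exp_sum S \<sigma> x + exp_sum T (\<lambda>n. s * a n) x" for s x
  proof -
    have "exp_sum X (f s) x = exp_sum S (f s) x + exp_sum T (f s) x"
      unfolding X using fin disj by (rule exp_sum_union_disjoint)
    also have "exp_sum S (f s) x = exp_sum S \<sigma> x"
      by (rule exp_sum_cong) (simp add: f_def)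
    also have "exp_sum T (f s) x = exp_sum T (\<lambda>n. s * a n) x"
      using disj by (intro exp_sum_cong) (auto simp: f_def)
    finally show ?thesis .
  qed
  have "2 * integral {0..1} (\<lambda>x. norm (exp_sum T a x)) =
      integral {0..1} (\<lambda>x. 2 * norm (exp_sum T a x))"
    by simp
  also have "\<dots> \<le> integral {0..1} (\<lambda>x. norm (exp_sum X (f 1) x) + norm (exp_sum X (f (-1)) x))"
  proof (intro integral_le integrable_add int)
    show "(\<lambda>x. 2 * norm (exp_sum T a x)) integrable_on {0..1}"
      by (intro integrable_continuous_real continuous_intros)
    \<comment> \<open>The contribution of \<open>S\<close> cancels in the difference of the two
      sums, which leaves twice the sum over \<open>T\<close>.\<close>
    show "2 * norm (exp_sum T a x) \<le> norm (exp_sum X (f 1) x) + norm (exp_sum X (f (-1)) x)" for x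
      using norm_triangle_ineq4[of "exp_sum X (f 1) x" "exp_sum X (f (-1)) x"]
      by (simp add: split exp_sum_uminus norm_mult flip: mult_2)
  qed
  also have "\<dots> = I 1 + I (-1)"
    unfolding I_def by (intro integral_add int)
  finally have "I 1 \<ge> 5 / 9 * sqrt (card T) \<or> I (-1) \<ge> 5 / 9 * sqrt (card T)"
    using L1 by linarith
  then obtain s where s: "s \<in> {-1, 1}" "I s \<ge> 5 / 9 * sqrt (card T)"
    by blast
  \<comment> \<open>After squaring, \<open>card T\<close> being at least half of
    \<open>card X\<close> suffices, since (5/9)^2 / 2 = 25/162 exceeds 1/9 = 18/162.\<close>
  have "1 / 3 * sqrt (card X) \<le> 5 / 9 * sqrt (card T)"
  proof (rule power2_le_imp_le)
    show "(1 / 3 * sqrt (card X))\<^sup>2 \<le> (5 / 9 * sqrt (card T))\<^sup>2"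
      using cardT by (simp add: power_mult_distrib power2_eq_square)
  qed simp
  with s have "I s \<ge> 1 / 3 * sqrt (card X)"
    by simp
  then have "fourier_ratio R (f s) \<ge> 1 / 3"
    using pos by (simp add: fourier_ratio_sign_function[OF f[OF s(1)]] I_def field_simps
        flip: X_def)
  then show "\<exists>f\<in>large_FR_class R (1/3). \<forall>n\<in>S. f n = \<sigma> n"
    using f[OF s(1)] by (intro bexI[of _ "f s"]) (auto simp: large_FR_class_def f_def)
qed

text \<open>On \<open>nat\<close>, \<open>Sup\<close> is known to dominate the members only of sets
  bounded above; finiteness of \<open>X\<close> provides the bound.\<close>

lemma card_le_VC_dim:
  assumes "finite X" "S \<subseteq> X" "shatters F S"
  shows "card S \<le> VC_dim X F"
proof -
  have "finite (card ` {S. S \<subseteq> X \<and> shatters F S})"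
    using assms(1) by simp
  then show ?thesis
    unfolding VC_dim_def using assms by (intro cSup_upper bdd_above_finite) auto
qed

section \<open>Positive density of the squarefree integers\<close>

text \<open>The sum over \<open>d \<ge> 3\<close> telescopes against \<open>1 / (d - 1) - 1 / d\<close>.\<close>

lemma sum_inverse_squares_le:
  assumes "n \<ge> 2"
  shows "(\<Sum>d=2..n. 1 / (real d)\<^sup>2) \<le> 3 / 4 - 1 / n"
  using assms
proof (induction n rule: dec_induct)
  case base
  \<comment> \<open>Equality holds here: 1/4 = 3/4 - 1/2.\<close>
  show ?case by simp
next
  case (step n)
  have "1 / (real (Suc n))\<^sup>2 \<le> 1 / n - 1 / real (Suc n)"
    using step.hyps(1) by (simp add: divide_simps power2_eq_square add_pos_pos)
  then show ?case
    using step by simp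
qed

text \<open>A union bound: every other integer up to \<open>R\<close> is a multiple of some
  \<open>d\<^sup>2\<close> with \<open>d \<ge> 2\<close>, and these multiples number at most 3/4 of
  \<open>R\<close> in total.\<close>

lemma card_sqfree_upto_ge: "real (card (sqfree_upto R)) \<ge> R / 4"
proof (cases "R \<ge> 2")
  case True
  define M where "M d = (\<lambda>k. k * d\<^sup>2) ` {1..R div d\<^sup>2}" for d
  have "{1..R} \<subseteq> sqfree_upto R \<union> (\<Union>d\<in>{2..R}. M d)"
  proof
    fix n assume n: "n \<in> {1..R}"
    show "n \<in> sqfree_upto R \<union> (\<Union>d\<in>{2..R}. M d)"
    proof (cases "squarefree n")
      case True
      with n show ?thesis by (simp add: sqfree_upto_def)
    next
      case False
      then obtain d where d: "d\<^sup>2 dvd n" "d \<noteq> 1"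
        by (auto simp: squarefree_def)
      then obtain k where k: "n = k * d\<^sup>2"
        by (metis dvd_def mult.commute)
      with n have "k \<ge> 1" "d \<ge> 1"
        by (auto intro!: Suc_leI gr0I)
      have "d \<le> d\<^sup>2"
        by (simp add: power2_nat_le_imp_le power2_eq_square)
      also have "d\<^sup>2 \<le> R"
        using n d dvd_imp_le[of "d\<^sup>2" n] by auto
      finally have "d \<in> {2..R}"
        using d \<open>d \<ge> 1\<close> by auto
      moreover have "k \<le> R div d\<^sup>2"
        using n k \<open>d \<ge> 1\<close> by (simp add: less_eq_div_iff_mult_less_eq)
      ultimately have "n \<in> M d"
        using k \<open>k \<ge> 1\<close> unfolding M_def by auto
      with \<open>d \<in> {2..R}\<close> show ?thesis by blast
    qed
  qed
  then have "card {1..R} \<le> card (sqfree_upto R \<union> (\<Union>d\<in>{2..R}. M d))"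
    by (intro card_mono) (auto simp: M_def)
  also have "\<dots> \<le> card (sqfree_upto R) + card (\<Union>d\<in>{2..R}. M d)"
    by (rule card_Un_le)
  also have "card (\<Union>d\<in>{2..R}. M d) \<le> (\<Sum>d=2..R. card (M d))"
    by (rule card_UN_le) simp
  also have "\<dots> \<le> (\<Sum>d=2..R. R div d\<^sup>2)"
    unfolding M_def by (intro sum_mono order_trans[OF card_image_le]) auto
  finally have "real R \<le> real (card (sqfree_upto R)) + (\<Sum>d=2..R. real (R div d\<^sup>2))"
    by (simp flip: of_nat_sum of_nat_add)
  also have "(\<Sum>d=2..R. real (R div d\<^sup>2)) \<le> (\<Sum>d=2..R. R * (1 / (real d)\<^sup>2))"
    by (intro sum_mono order_trans[OF of_nat_div_le_of_nat]) simp
  also have "\<dots> = R * (\<Sum>d=2..R. 1 / (real d)\<^sup>2)"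
    by (simp add: sum_distrib_left)
  also have "\<dots> \<le> R * (3 / 4)"
  proof (rule mult_left_mono)
    have "1 / real R \<ge> 0" by simp
    with sum_inverse_squares_le[OF True] show "(\<Sum>d=2..R. 1 / (real d)\<^sup>2) \<le> 3 / 4"
      by linarith
  qed simp
  finally show ?thesis by simp
next
  case False
  then consider "R = 0" | "R = 1" by linarith
  then show ?thesis
  proof cases
    case 2
    then have "sqfree_upto R = {1}" by (auto simp: sqfree_upto_def)
    with 2 show ?thesis by simp
  qed simp
qed

theorem theorem1p6:
  "\<exists>c\<^sub>0 > (0::real). \<exists>c > (0::real). \<forall>\<^sub>F R in sequentially.
     real (VC_dim (sqfree_upto R) (large_FR_class R c\<^sub>0)) \<ge> c * real R"
proof (intro exI conjI)
  show "\<forall>\<^sub>F R in sequentially.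
     real (VC_dim (sqfree_upto R) (large_FR_class R (1/3))) \<ge> 1/16 * real R"
    \<comment> \<open>Halving with rounding gives \<open>card S\<close> \<ge> (R/4 - 1)/2 = R/8 -
      1/2, which is at least R/16 exactly when R \<ge> 8.\<close>
    using eventually_ge_at_top[of 8]
  proof eventually_elim
    case (elim R)
    obtain S where S: "S \<subseteq> sqfree_upto R" "card S = card (sqfree_upto R) div 2"
      using obtain_subset_with_card_n[of "card (sqfree_upto R) div 2" "sqfree_upto R"] by auto
    have "card S \<le> VC_dim (sqfree_upto R) (large_FR_class R (1/3))"
      using S elim by (intro card_le_VC_dim shatters_large_FR_class) auto
    moreover have "real (card (sqfree_upto R)) \<le> 2 * real (card S) + 1"
      using S(2) by linarith
    ultimately show ?case
      using card_sqfree_upto_ge[of R] elim by linarith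
  qed
qed auto

end
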